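(* For every $0<\alpha<1$ there exist positive vectors $\theta,\eta\in(0,\infty)^3$ such that $\eta\prec\theta$ and $F_\eta(x)-F_\theta(x)$ changes signs at least three times as $x$ increases from $0$ to $\infty$, where $F_\theta$ denotes the distribution function of $\theta_1X_1+\theta_2X_2+\theta_3X_3$ with $X_1,X_2,X_3$ iid gamma$(\alpha,1)$ random variables (and likewise for $F_\eta$).
   Context: gamma$(\alpha,1)$ has density $t^{\alpha-1}e^{-t}/\Gamma(\alpha)$ on $(0,\infty)$. $\eta\prec\theta$ denotes majorization: with $\theta_{(1)}\le\dots\le\theta_{(n)}$ the increasing rearrangement, $\sum_{i=1}^l\eta_{(i)}\ge\sum_{i=1}^l\theta_{(i)}$ for $1\le l\le n$, with equality at $l=n$. Sign changes of a function on $(0,\infty)$ are counted in the usual way, discarding zeros. *)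

theory Defs
  imports "HOL-Probability.Probability" "HOL-Library.Multiset"
begin

definition gamma_density :: "real \<Rightarrow> real \<Rightarrow> real" where
  "gamma_density \<alpha> t = (if 0 < t then t powr (\<alpha> - 1) * exp (- t) / Gamma \<alpha> else 0)"

definition gamma_measure :: "real \<Rightarrow> real measure" where
  "gamma_measure \<alpha> = density lborel (\<lambda>t. ennreal (gamma_density \<alpha> t))"

text \<open>
  The iid variables \<open>X\<^sub>i\<close> are realized as the coordinates of the product space
  \<open>\<Pi>\<^sub>M i\<in>UNIV. gamma_measure \<alpha>\<close>.  The lemma \<open>weighted_gamma_cdf_iid\<close> below says
  that any other realization gives the same distribution function.
\<close>

definition weighted_gamma_cdf :: "real \<Rightarrow> real ^ 'n \<Rightarrow> real \<Rightarrow> real" where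
  "weighted_gamma_cdf \<alpha> \<theta> =
     cdf (distr (\<Pi>\<^sub>M i\<in>(UNIV :: 'n set). gamma_measure \<alpha>) borel
           (\<lambda>X. \<Sum>i\<in>UNIV. \<theta> $ i * X i))"

definition increasing_rearrangement :: "real ^ 'n \<Rightarrow> real list" where
  "increasing_rearrangement \<theta> = sorted_list_of_multiset (image_mset (\<lambda>i. \<theta> $ i) (mset_set UNIV))"

text \<open>List positions start at \<open>0\<close>, so \<open>\<Sum>i<l\<close> runs over the \<open>l\<close> smallest entries.\<close>

definition majorized_by :: "real ^ 'n \<Rightarrow> real ^ 'n \<Rightarrow> bool" (infix "\<prec>\<^sub>m" 50) where
  "\<eta> \<prec>\<^sub>m \<theta> \<longleftrightarrow>
     (\<forall>l\<in>{1..CARD('n)}.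
        (\<Sum>i<l. increasing_rearrangement \<eta> ! i) \<ge> (\<Sum>i<l. increasing_rearrangement \<theta> ! i)) \<and>
     (\<Sum>i<CARD('n). increasing_rearrangement \<eta> ! i) =
       (\<Sum>i<CARD('n). increasing_rearrangement \<theta> ! i)"

definition sign_changes_list :: "real list \<Rightarrow> nat" where
  "sign_changes_list ys =
     (let zs = filter (\<lambda>y. y \<noteq> 0) ys in card {i. Suc i < length zs \<and> zs ! i * zs ! Suc i < 0})"

text \<open>
  The number of sign changes of a function is the supremum, possibly infinite, of the numbers of
  sign changes of its values along finite increasing sequences of points.
\<close>

definition sign_changes_on :: "real set \<Rightarrow> (real \<Rightarrow> real) \<Rightarrow> enat" where
  "sign_changes_on S f =
     (SUP xs\<in>{xs. sorted_wrt (<) xs \<and> set xs \<subseteq> S}. enat (sign_changes_list (map f xs)))"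

lemma gamma_density_measurable [measurable]: "gamma_density \<alpha> \<in> borel_measurable borel"
  unfolding gamma_density_def by measurable

lemma space_gamma_measure [simp]: "space (gamma_measure \<alpha>) = UNIV"
  by (simp add: gamma_measure_def)

lemma sets_gamma_measure [simp, measurable_cong]: "sets (gamma_measure \<alpha>) = sets borel"
  by (simp add: gamma_measure_def)

lemma prob_space_gamma_measure:
  assumes "0 < \<alpha>"
  shows "prob_space (gamma_measure \<alpha>)"
proof
  have G: "Gamma \<alpha> > 0"
    using assms by (rule Gamma_real_pos)
  have "emeasure (gamma_measure \<alpha>) (space (gamma_measure \<alpha>)) =
      (\<integral>\<^sup>+ t. ennreal (gamma_density \<alpha> t) \<partial>lborel)"
    by (simp add: gamma_measure_def emeasure_density)
  also have "\<dots> = (\<integral>\<^sup>+ t. ennreal (inverse (Gamma \<alpha>)) *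
      ennreal (indicator {0..} t * t powr (\<alpha> - 1) / exp t) \<partial>lborel)"
    using G by (intro nn_integral_cong)
      (auto simp: gamma_density_def indicator_def exp_minus field_simps simp flip: ennreal_mult')
  also have "\<dots> = ennreal (inverse (Gamma \<alpha>)) * ennreal (Gamma \<alpha>)"
    using assms by (subst nn_integral_cmult) (simp_all add: Gamma_conv_nn_integral_real)
  also have "\<dots> = 1"
    using G by (simp flip: ennreal_mult')
  finally show "emeasure (gamma_measure \<alpha>) (space (gamma_measure \<alpha>)) = 1" .
qed

lemma (in prob_space) weighted_gamma_cdf_iid:
  fixes X :: "'n::finite \<Rightarrow> 'a \<Rightarrow> real"
  assumes "indep_vars (\<lambda>_. borel) X UNIV"
    and "\<And>i. distributed M lborel (X i) (\<lambda>t. ennreal (gamma_density \<alpha> t))"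
  shows "prob {\<omega>\<in>space M. (\<Sum>i\<in>UNIV. \<theta> $ i * X i \<omega>) \<le> x} = weighted_gamma_cdf \<alpha> \<theta> x"
proof -
  have rv [measurable]: "random_variable borel (X i)" for i
    using assms(2)[of i] by (auto dest: distributed_measurable)
  have "distr M borel (X i) = gamma_measure \<alpha>" for i
    using distributed_distr_eq_density[OF assms(2)[of i]]
    by (simp add: gamma_measure_def cong: distr_cong)
  then have joint: "distr M (\<Pi>\<^sub>M i\<in>UNIV. borel) (\<lambda>\<omega>. \<lambda>i\<in>UNIV. X i \<omega>) =
      (\<Pi>\<^sub>M i\<in>UNIV. gamma_measure \<alpha>)"
    using assms(1) by (subst (asm) indep_vars_iff_distr_eq_PiM) simp_all
  have "weighted_gamma_cdf \<alpha> \<theta> = cdf (distr M borel (\<lambda>\<omega>. \<Sum>i\<in>UNIV. \<theta> $ i * X i \<omega>))"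
    unfolding weighted_gamma_cdf_def joint[symmetric]
    by (subst distr_distr) (simp_all add: o_def)
  then show ?thesis
    by (auto simp: cdf_def measure_distr intro!: arg_cong[where f = prob])
qed

end

theory Submission
  imports Defs
begin

text \<open>
  Put two entries of order \<open>\<delta>\<close> next to an entry near \<open>1\<close>, and let \<open>G\<close>, \<open>g\<close> be the distribution
  function and the density of gamma\<open>(\<alpha>, 1)\<close>.  Expanding \<open>G\<close> to second order in the two small summands
  shows that spreading the small entries changes the distribution function at order \<open>\<delta>\<^sup>2\<close> by a
  multiple of \<open>g'(x)\<close>, while a transfer \<open>\<kappa>\<close> from the small entries to the large one changes it by
  \<open>\<kappa> g(x) (\<alpha> - x)\<close>, because the mean is preserved.  With \<open>\<kappa> = \<delta>\<^sup>2 / \<alpha>\<close> both effects have the same order, and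
  \[ \frac{F_\eta(x) - F_\theta(x)}{\delta^2} \longrightarrow
     g(x) \Bigl(\frac{x}{\alpha} - 1 + \frac{\alpha}{4} \Bigl(1 + \frac{1 - \alpha}{x}\Bigr)\Bigr). \]
  Because \<open>\<alpha> < 1\<close> the limit is positive for small \<open>x\<close>, negative at \<open>\<alpha> / 2\<close> and positive at \<open>2\<alpha>\<close>.  For fixed
  \<open>\<delta>\<close> a further change occurs near \<open>0\<close>, where \<open>F_\<theta>(x)\<close> is asymptotic to a multiple of
  \<open>x\<^bsup>3\<alpha>\<^esup> \<Prod>\<theta>\<^sub>i\<^bsup>-\<alpha>\<^esup>\<close> and the more balanced vector has the larger product.
\<close>

section \<open>Gamma distribution: moments, derivatives and a Taylor bound\<close>

lemma gamma_density_nonneg [simp]: "0 < \<alpha> \<Longrightarrow> 0 \<le> gamma_density \<alpha> t"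
  by (simp add: gamma_density_def Gamma_real_pos less_imp_le)

lemma gamma_density_pos: "0 < \<alpha> \<Longrightarrow> 0 < t \<Longrightarrow> 0 < gamma_density \<alpha> t"
  by (simp add: gamma_density_def Gamma_real_pos)

lemma has_bochner_integral_gamma_density:
  assumes "0 < \<alpha>"
  shows "has_bochner_integral lborel (gamma_density \<alpha>) 1"
proof (rule has_bochner_integral_nn_integral)
  interpret prob_space "gamma_measure \<alpha>" using assms by (rule prob_space_gamma_measure)
  show "(\<integral>\<^sup>+ x. ennreal (gamma_density \<alpha> x) \<partial>lborel) = ennreal 1"
    using emeasure_space_1 by (simp add: gamma_measure_def emeasure_density)
qed (use assms in auto)

text \<open>A power of \<open>t\<close> only shifts the shape parameter from \<alpha> to \<alpha> +
  k, so every moment reduces to the total mass of another gamma density.\<close>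

lemma power_times_gamma_density:
  assumes "0 < \<alpha>"
  shows "t ^ k * gamma_density \<alpha> t = pochhammer \<alpha> k * gamma_density (\<alpha> + real k) t"
proof (cases "0 < t")
  case True
  have "t ^ k * t powr (\<alpha> - 1) = t powr (\<alpha> + real k - 1)"
    using True by (simp add: powr_add powr_diff powr_realpow)
  moreover have "pochhammer \<alpha> k = Gamma (\<alpha> + real k) / Gamma \<alpha>"
    using assms by (intro pochhammer_Gamma) (auto elim!: nonpos_Ints_cases)
  moreover have "Gamma \<alpha> > 0" "Gamma (\<alpha> + real k) > 0"
    using assms by (auto intro!: Gamma_real_pos)
  ultimately have "t ^ k * gamma_density \<alpha> t = t powr (\<alpha> + real k - 1) * exp (- t) / Gamma \<alpha>"
      "pochhammer \<alpha> k * gamma_density (\<alpha> + real k) t =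
        t powr (\<alpha> + real k - 1) * exp (- t) / Gamma \<alpha>"
    using True by (simp_all add: gamma_density_def)
  then show ?thesis by simp
qed (simp add: gamma_density_def)

lemma gamma_moment:
  assumes "0 < \<alpha>"
  shows "has_bochner_integral (gamma_measure \<alpha>) (\<lambda>t. t ^ k) (pochhammer \<alpha> k)"
  unfolding gamma_measure_def
proof (rule has_bochner_integral_density)
  have "has_bochner_integral lborel (\<lambda>t. pochhammer \<alpha> k * gamma_density (\<alpha> + real k) t)
      (pochhammer \<alpha> k * 1)"
    using assms by (intro has_bochner_integral_mult_right has_bochner_integral_gamma_density) auto
  then show "has_bochner_integral lborel (\<lambda>t. gamma_density \<alpha> t *\<^sub>R t ^ k) (pochhammer \<alpha> k)"
    by (simp add: power_times_gamma_density[OF assms, symmetric] mult.commute)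
qed (use assms in auto)

lemma real_distribution_gamma_measure: "0 < \<alpha> \<Longrightarrow> real_distribution (gamma_measure \<alpha>)"
  by (simp add: real_distribution_def real_distribution_axioms_def prob_space_gamma_measure)

lemma AE_gamma_measure_pos: "AE t in gamma_measure \<alpha>. 0 < t"
  unfolding gamma_measure_def by (subst AE_density) (auto simp: gamma_density_def)

lemma continuous_on_gamma_density: "continuous_on {0<..} (gamma_density \<alpha>)"
proof -
  have "continuous_on {0<..} (\<lambda>t. t powr (\<alpha> - 1) * exp (- t) / Gamma \<alpha>)"
    by (cases "Gamma \<alpha> = 0") (auto intro!: continuous_intros)
  then show ?thesis
    by (rule continuous_on_eq) (simp add: gamma_density_def)
qed

text \<open>For \<alpha> < 1 the density is unbounded at 0, so the fundamental theorem of calculus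
  is applied on \<open>{x / 2..2 * x}\<close>; the mass up to \<open>x / 2\<close> enters as a
  constant.\<close>

lemma gamma_cdf_has_derivative:
  assumes "0 < \<alpha>" "0 < x"
  shows "(cdf (gamma_measure \<alpha>) has_real_derivative gamma_density \<alpha> x) (at x)"
proof -
  interpret real_distribution "gamma_measure \<alpha>"
    using assms(1) by (rule real_distribution_gamma_measure)
  let ?a = "x / 2" and ?b = "2 * x"
  have cont: "continuous_on {?a..?b} (gamma_density \<alpha>)"
    using continuous_on_gamma_density by (rule continuous_on_subset) (use assms in auto)
  have eq: "cdf (gamma_measure \<alpha>) y = cdf (gamma_measure \<alpha>) ?a + integral {?a..y} (gamma_density \<alpha>)"
    if "?a < y" for y
  proof -
    have int: "set_integrable lborel {?a<..y} (gamma_density \<alpha>)"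
      unfolding set_integrable_def using has_bochner_integral_gamma_density[OF assms(1)]
      by (intro integrable_mult_indicator) (auto simp: has_bochner_integral_iff)
    have "cdf (gamma_measure \<alpha>) y - cdf (gamma_measure \<alpha>) ?a = measure (gamma_measure \<alpha>) {?a<..y}"
      using that by (rule cdf_diff_eq)
    also have "ennreal \<dots> = (\<integral>\<^sup>+ t. ennreal (indicator {?a<..y} t *\<^sub>R gamma_density \<alpha> t) \<partial>lborel)"
      unfolding emeasure_eq_measure[symmetric] unfolding gamma_measure_def
      by (subst emeasure_density) (auto intro!: nn_integral_cong split: split_indicator)
    also have "\<dots> = ennreal (LINT t:{?a<..y}|lborel. gamma_density \<alpha> t)"
      unfolding set_lebesgue_integral_def using int assms(1)
      by (intro nn_integral_eq_integral) (auto simp: set_integrable_def)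
    finally have "cdf (gamma_measure \<alpha>) y - cdf (gamma_measure \<alpha>) ?a =
        (LINT t:{?a<..y}|lborel. gamma_density \<alpha> t)"
      using assms(1) that by (subst (asm) ennreal_inj)
        (auto simp: set_lebesgue_integral_def cdf_nondecreasing intro!: integral_nonneg_AE)
    also have "\<dots> = integral {?a<..y} (gamma_density \<alpha>)"
      using int by (rule set_borel_integral_eq_integral)
    also have "\<dots> = integral {?a..y} (gamma_density \<alpha>)"
      by (rule integral_spike_set) (auto intro: negligible_subset[OF negligible_sing[of ?a]])
    finally show ?thesis by simp
  qed
  have "((\<lambda>y. integral {?a..y} (gamma_density \<alpha>)) has_real_derivative gamma_density \<alpha> x)
      (at x within {?a..?b})"
    using cont assms by (intro integral_has_real_derivative) auto
  then have "((\<lambda>y. integral {?a..y} (gamma_density \<alpha>)) has_real_derivative gamma_density \<alpha> x) (at x)"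
    using assms by (subst (asm) at_within_Icc_at) auto
  then have "((\<lambda>y. cdf (gamma_measure \<alpha>) ?a + integral {?a..y} (gamma_density \<alpha>))
      has_real_derivative gamma_density \<alpha> x) (at x)"
    by (auto intro!: derivative_eq_intros)
  then show ?thesis
    by (rule has_field_derivative_transform_within_open[where S = "{?a<..}"]) (use assms in \<open>simp_all add: eq\<close>)
qed

lemma gamma_density_has_derivative:
  assumes "0 < x"
  shows "(gamma_density \<alpha> has_real_derivative gamma_density \<alpha> x * ((\<alpha> - 1) / x - 1)) (at x)"
proof -
  have "((\<lambda>t. t powr (\<alpha> - 1) * exp (- t) / Gamma \<alpha>) has_real_derivative
      gamma_density \<alpha> x * ((\<alpha> - 1) / x - 1)) (at x)"
  proof (rule DERIV_cong)
    show "((\<lambda>t. t powr (\<alpha> - 1) * exp (- t) / Gamma \<alpha>) has_real_derivative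
        (x powr (\<alpha> - 1) * (exp (- x) * - 1) + (\<alpha> - 1) * x powr (\<alpha> - 1 - 1) * exp (- x)) / Gamma \<alpha>)
        (at x)"
      using assms
      by (intro DERIV_cdivide DERIV_mult' has_real_derivative_powr DERIV_fun_exp DERIV_minus DERIV_ident)
    show "(x powr (\<alpha> - 1) * (exp (- x) * - 1) + (\<alpha> - 1) * x powr (\<alpha> - 1 - 1) * exp (- x)) / Gamma \<alpha> =
        gamma_density \<alpha> x * ((\<alpha> - 1) / x - 1)"
      using assms powr_diff[of x "\<alpha> - 1" 1]
      by (simp add: gamma_density_def right_diff_distrib) (simp add: ring_distribs diff_divide_distrib mult_ac)
  qed
  then show ?thesis
    by (rule has_field_derivative_transform_within_open[where S = "{0<..}"])
      (use assms in \<open>simp_all add: gamma_density_def\<close>)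
qed

lemma gamma_density_has_second_derivative:
  assumes "0 < x"
  shows "((\<lambda>x. gamma_density \<alpha> x * ((\<alpha> - 1) / x - 1)) has_real_derivative
    gamma_density \<alpha> x * (((\<alpha> - 1) / x - 1)\<^sup>2 - (\<alpha> - 1) / x\<^sup>2)) (at x)"
proof (rule DERIV_cong)
  show "((\<lambda>x. gamma_density \<alpha> x * ((\<alpha> - 1) / x - 1)) has_real_derivative
      gamma_density \<alpha> x * ((1 - \<alpha>) / x\<^sup>2) +
      gamma_density \<alpha> x * ((\<alpha> - 1) / x - 1) * ((\<alpha> - 1) / x - 1)) (at x)"
  proof (rule DERIV_mult'[OF gamma_density_has_derivative])
    show "((\<lambda>x. (\<alpha> - 1) / x - 1) has_real_derivative (1 - \<alpha>) / x\<^sup>2) (at x)"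
      using assms by (auto intro!: derivative_eq_intros simp: power2_eq_square)
  qed (use assms in simp)
  have "(1 - \<alpha>) / x\<^sup>2 = - ((\<alpha> - 1) / x\<^sup>2)"
    by (simp add: diff_divide_distrib)
  then show "gamma_density \<alpha> x * ((1 - \<alpha>) / x\<^sup>2) +
      gamma_density \<alpha> x * ((\<alpha> - 1) / x - 1) * ((\<alpha> - 1) / x - 1) =
      gamma_density \<alpha> x * (((\<alpha> - 1) / x - 1)\<^sup>2 - (\<alpha> - 1) / x\<^sup>2)"
    by algebra
qed

lemma gamma_cdf_pos:
  assumes "0 < \<alpha>" "0 < x"
  shows "0 < cdf (gamma_measure \<alpha>) x"
proof -
  interpret real_distribution "gamma_measure \<alpha>"
    using assms(1) by (rule real_distribution_gamma_measure)
  have "cdf (gamma_measure \<alpha>) (x / 2) < cdf (gamma_measure \<alpha>) x"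
  proof (rule DERIV_pos_imp_increasing[where f = "cdf (gamma_measure \<alpha>)"])
    fix y assume "x / 2 \<le> y" "y \<le> x"
    then have "0 < y" using assms by simp
    with assms show "\<exists>d. (cdf (gamma_measure \<alpha>) has_real_derivative d) (at y) \<and> 0 < d"
      by (blast intro: gamma_cdf_has_derivative gamma_density_pos)
  qed (use assms in simp)
  then show ?thesis
    using cdf_nonneg[of "x / 2"] by linarith
qed

text \<open>The derivatives may blow up at 0, but \<open>y - s\<close> can be any point left of
  \<open>y\<close>. For \<open>s\<close> at most half of \<open>l\<close>, Taylor's theorem applies
  away from 0. For larger \<open>s\<close>, boundedness of \<open>f\<close> suffices, because a
  multiple of \<open>s ^ 3\<close> dominates all terms. Uniformity in \<open>y\<close> matters
  later, when the base point moves with \<delta>.\<close>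

lemma taylor_remainder_half_line:
  fixes f f1 f2 f3 :: "real \<Rightarrow> real"
  assumes bnd: "\<And>x. \<bar>f x\<bar> \<le> 1"
    and d: "\<And>x. 0 < x \<Longrightarrow> (f has_real_derivative f1 x) (at x)"
      "\<And>x. 0 < x \<Longrightarrow> (f1 has_real_derivative f2 x) (at x)"
      "\<And>x. 0 < x \<Longrightarrow> (f2 has_real_derivative f3 x) (at x)"
    and cont: "continuous_on {0<..} f3"
    and "0 < l"
  shows "\<exists>K\<ge>0. \<forall>y\<in>{l..u}. \<forall>s\<ge>0. \<bar>f (y - s) - (f y - f1 y * s + f2 y / 2 * s\<^sup>2)\<bar> \<le> K * s ^ 3"
proof -
  define r where "r = l / 2"
  have r: "0 < r" "l = 2 * r" using \<open>0 < l\<close> by (auto simp: r_def)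
  have bounded_on: "\<exists>B\<ge>0. \<forall>x\<in>{r..u}. \<bar>g x\<bar> \<le> B" if "continuous_on {0<..} g" for g :: "real \<Rightarrow> real"
  proof -
    have "compact (g ` {r..u})"
      using r by (intro compact_continuous_image continuous_on_subset[OF that]) auto
    then obtain B where "\<forall>x\<in>g ` {r..u}. norm x \<le> B"
      using compact_imp_bounded bounded_iff by metis
    then show ?thesis by (intro exI[of _ "max B 0"]) force
  qed
  have "continuous_on {0<..} f1" "continuous_on {0<..} f2"
    using d by (auto intro!: continuous_at_imp_continuous_on DERIV_isCont)
  then obtain B1 B2 B3 where B: "0 \<le> B1" "0 \<le> B2" "0 \<le> B3"
    "\<And>x. x \<in> {r..u} \<Longrightarrow> \<bar>f1 x\<bar> \<le> B1" "\<And>x. x \<in> {r..u} \<Longrightarrow> \<bar>f2 x\<bar> \<le> B2"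
    "\<And>x. x \<in> {r..u} \<Longrightarrow> \<bar>f3 x\<bar> \<le> B3"
    using bounded_on[of f1] bounded_on[of f2] bounded_on[OF cont] by metis
  \<comment> \<open>The first summand is the Lagrange constant for s \<le> r; the others absorb the
    terms of order 0, 1 and 2 when s > r.\<close>
  define K where "K = B3 / 6 + (2 / r ^ 3 + B1 / r\<^sup>2 + B2 / (2 * r))"
  have K: "K \<ge> B3 / 6" "K \<ge> 2 / r ^ 3 + B1 / r\<^sup>2 + B2 / (2 * r)" "K \<ge> 0"
    unfolding K_def using B r by auto
  have "\<bar>f (y - s) - (f y - f1 y * s + f2 y / 2 * s\<^sup>2)\<bar> \<le> K * s ^ 3"
    if y: "y \<in> {l..u}" and s: "0 \<le> s" for y s
  proof (cases "s \<le> r")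
    case True
    show ?thesis
    proof (cases "s = 0")
      case False
      define diff where "diff m = (if m = 0 then f else if m = 1 then f1 else if m = 2 then f2 else f3)"
        for m :: nat
      have D: "\<forall>m t. m < 3 \<and> y - s \<le> t \<and> t \<le> y \<longrightarrow> DERIV (diff m) t :> diff (Suc m) t"
      proof (intro allI impI)
        fix m t assume mt: "m < (3::nat) \<and> y - s \<le> t \<and> t \<le> y"
        then have "0 < t" using y s True r by auto
        moreover have "m = 0 \<or> m = 1 \<or> m = 2" using mt by auto
        ultimately show "DERIV (diff m) t :> diff (Suc m) t"
          using d by (auto simp: diff_def)
      qed
      have "\<exists>t. y - s < t \<and> t < y \<and> f (y - s) =
          (\<Sum>m<3. (diff m y / fact m) * (y - s - y) ^ m) + (diff 3 t / fact 3) * (y - s - y) ^ 3"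
        by (rule Taylor_down[OF _ _ D]) (use False s in \<open>auto simp: diff_def\<close>)
      then obtain t where t: "y - s < t" "t < y" "f (y - s) =
          (\<Sum>m<3. (diff m y / fact m) * (y - s - y) ^ m) + (diff 3 t / fact 3) * (y - s - y) ^ 3"
        by blast
      have "f (y - s) - (f y - f1 y * s + f2 y / 2 * s\<^sup>2) = - f3 t / 6 * s ^ 3"
        using t(3) by (simp add: diff_def numeral_3_eq_3 fact_numeral power2_eq_square)
      then have "\<bar>f (y - s) - (f y - f1 y * s + f2 y / 2 * s\<^sup>2)\<bar> = \<bar>f3 t\<bar> / 6 * s ^ 3"
        using s by (simp add: abs_mult)
      \<comment> \<open>The intermediate point stays in \<open>{r..u}\<close>, since y - s \<ge> 2r
        - r.\<close>
      also have "\<bar>f3 t\<bar> \<le> B3"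
        using t y s True r by (intro B) auto
      also have "B3 / 6 * s ^ 3 \<le> K * s ^ 3"
        using K s by (intro mult_right_mono) auto
      finally show ?thesis using s by (simp add: mult_right_mono divide_right_mono)
    qed simp
  next
    case False
    have yr: "y \<in> {r..u}" using y r by auto
    \<comment> \<open>Since s / r \<ge> 1, each lower-order term may be multiplied by the power of
      \<open>s / r\<close> that makes it cubic in \<open>s\<close>.\<close>
    have q: "1 \<le> s / r" using False r by auto
    have "\<bar>f1 y * s\<bar> \<le> B1 * s" "\<bar>f2 y / 2 * s\<^sup>2\<bar> \<le> B2 / 2 * s\<^sup>2"
      unfolding abs_mult using B(4,5)[OF yr] s by (auto intro!: mult_right_mono)
    then have "\<bar>f (y - s) - (f y - f1 y * s + f2 y / 2 * s\<^sup>2)\<bar> \<le>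
        2 * 1 + B1 * s * 1 + B2 / 2 * s\<^sup>2 * 1"
      using bnd[of "y - s"] bnd[of y] by linarith
    also have "\<dots> \<le> 2 * (s / r) ^ 3 + B1 * s * (s / r) ^ 2 + B2 / 2 * s\<^sup>2 * (s / r)"
      using B s q by (intro add_mono mult_left_mono one_le_power) auto
    also have "\<dots> = (2 / r ^ 3 + B1 / r\<^sup>2 + B2 / (2 * r)) * s ^ 3"
      using r by (simp add: field_simps power2_eq_square power3_eq_cube)
    also have "\<dots> \<le> K * s ^ 3"
      using K s by (intro mult_right_mono) auto
    finally show ?thesis .
  qed
  then show ?thesis using K(3) by blast
qed

section \<open>Positivity and integral formulas for the distribution function of the weighted
  sum\<close>

lemma measurable_cdf_gamma [measurable]: "0 < \<alpha> \<Longrightarrow> cdf (gamma_measure \<alpha>) \<in> borel_measurable borel"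
  using real_distribution_gamma_measure[of \<alpha>]
  by (intro borel_measurable_mono monoI finite_borel_measure.cdf_nondecreasing)
    (simp_all add: real_distribution.finite_borel_measure_M)

lemma product_prob_space_gamma: "0 < \<alpha> \<Longrightarrow> product_prob_space (\<lambda>_. gamma_measure \<alpha>)"
  by (simp add: product_prob_space_def product_prob_space_axioms_def product_sigma_finite_def
      prob_space_gamma_measure prob_space_imp_sigma_finite)

lemma weighted_gamma_cdf_eq_measure:
  fixes \<theta> :: "real ^ 'n"
  shows "weighted_gamma_cdf \<alpha> \<theta> x =
    measure (\<Pi>\<^sub>M i\<in>UNIV. gamma_measure \<alpha>)
      {X \<in> space (\<Pi>\<^sub>M i\<in>UNIV. gamma_measure \<alpha>). (\<Sum>i\<in>UNIV. \<theta> $ i * X i) \<le> x}"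
  unfolding weighted_gamma_cdf_def cdf_def
  by (subst measure_distr) (auto intro!: arg_cong[where f = "measure _"])

lemma AE_PiM_gamma_pos:
  fixes I :: "'i set"
  assumes "0 < \<alpha>" "i \<in> I"
  shows "AE X in (\<Pi>\<^sub>M i\<in>I. gamma_measure \<alpha>). 0 < X i"
  using AE_gamma_measure_pos assms
  by (intro AE_PiM_component[where M = "\<lambda>_. gamma_measure \<alpha>"] prob_space_gamma_measure) auto

text \<open>The event contains a product of events of positive probability. Positivity is what later
  turns a comparison factor below 1 into a strict inequality.\<close>

lemma weighted_gamma_cdf_pos:
  fixes \<theta> :: "real ^ 'n"
  assumes "0 < \<alpha>" "\<And>i. 0 < \<theta> $ i" "0 < x"
  shows "0 < weighted_gamma_cdf \<alpha> \<theta> x"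
proof -
  let ?P = "\<Pi>\<^sub>M i\<in>(UNIV :: 'n set). gamma_measure \<alpha>"
  interpret product_prob_space "\<lambda>_ :: 'n. gamma_measure \<alpha>" UNIV
    using assms(1) by (rule product_prob_space_gamma)
  \<comment> \<open>The corner of the cube with all coordinates equal to \<open>r\<close> has
    weighted sum exactly \<open>x\<close>.\<close>
  define r where "r = x / (\<Sum>i\<in>UNIV. \<theta> $ i)"
  have sum: "0 < (\<Sum>i\<in>UNIV. \<theta> $ i)"
    using assms by (intro sum_pos) auto
  then have r: "0 < r" "(\<Sum>i\<in>UNIV. \<theta> $ i * r) = x"
    unfolding sum_distrib_right[symmetric] using assms(3) by (auto simp: r_def)
  have "0 < (\<Prod>i\<in>(UNIV :: 'n set). measure (gamma_measure \<alpha>) {..r})"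
    using gamma_cdf_pos[OF assms(1) r(1)] by (simp add: cdf_def)
  also have "\<dots> = measure ?P (Pi\<^sub>E UNIV (\<lambda>_. {..r}))"
    using measure_PiM_emb[of UNIV "\<lambda>_. {..r}"] by (simp add: prod_emb_def space_PiM restrict_UNIV)
  also have "\<dots> \<le> measure ?P {X \<in> space ?P. (\<Sum>i\<in>UNIV. \<theta> $ i * X i) \<le> x}"
  proof (rule P.finite_measure_mono)
    show "Pi\<^sub>E UNIV (\<lambda>_. {..r}) \<subseteq> {X \<in> space ?P. (\<Sum>i\<in>UNIV. \<theta> $ i * X i) \<le> x}"
    proof safe
      fix X :: "'n \<Rightarrow> real" assume "X \<in> Pi\<^sub>E UNIV (\<lambda>_. {..r})"
      then have "(\<Sum>i\<in>UNIV. \<theta> $ i * X i) \<le> (\<Sum>i\<in>UNIV. \<theta> $ i * r)"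
        using assms(2) by (intro sum_mono mult_left_mono) (auto simp: less_imp_le)
      then show "(\<Sum>i\<in>UNIV. \<theta> $ i * X i) \<le> x" using r by simp
    qed (simp add: space_PiM)
  qed measurable
  finally show ?thesis by (simp add: weighted_gamma_cdf_eq_measure)
qed

text \<open>The index 3 is singled out so that its coordinate becomes the inner integral when the
  product measure is split along the insertion.\<close>

lemma UNIV_3_insert: "(UNIV :: 3 set) = insert 3 {1, 2}"
  by (auto simp: UNIV_3)

text \<open>Fubini for the third coordinate. Positivity of the coordinates holds almost everywhere,
  so it can be put into the integrand.\<close>

lemma weighted_gamma_cdf_3_nn_integral:
  fixes \<theta> :: "real ^ 3"
  assumes "0 < \<alpha>"
  shows "ennreal (weighted_gamma_cdf \<alpha> \<theta> x) =
    (\<integral>\<^sup>+X. \<integral>\<^sup>+t. (if 0 < X 1 \<and> 0 < X 2 \<and> 0 < t \<and> \<theta> $ 1 * X 1 + \<theta> $ 2 * X 2 + \<theta> $ 3 * t \<le> x then 1 else 0)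
      \<partial>gamma_measure \<alpha> \<partial>(\<Pi>\<^sub>M i\<in>{1, 2 :: 3}. gamma_measure \<alpha>))"
proof -
  let ?P = "\<Pi>\<^sub>M i\<in>(UNIV :: 3 set). gamma_measure \<alpha>"
  interpret product_prob_space "\<lambda>_ :: 3. gamma_measure \<alpha>" UNIV
    using assms(1) by (rule product_prob_space_gamma)
  have "ennreal (weighted_gamma_cdf \<alpha> \<theta> x) =
      emeasure ?P {X \<in> space ?P. (\<Sum>i\<in>UNIV. \<theta> $ i * X i) \<le> x}"
    by (simp add: weighted_gamma_cdf_eq_measure P.emeasure_eq_measure)
  also have "\<dots> = (\<integral>\<^sup>+X. indicator {X \<in> space ?P. (\<Sum>i\<in>UNIV. \<theta> $ i * X i) \<le> x} X \<partial>?P)"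
    by (rule nn_integral_indicator[symmetric]) measurable
  also have "\<dots> = (\<integral>\<^sup>+X. (if 0 < X 1 \<and> 0 < X 2 \<and> 0 < X 3 \<and>
      \<theta> $ 1 * X 1 + \<theta> $ 2 * X 2 + \<theta> $ 3 * X 3 \<le> x then 1 else 0) \<partial>?P)"
  proof (rule nn_integral_cong_AE)
    show "AE X in ?P. indicator {X \<in> space ?P. (\<Sum>i\<in>UNIV. \<theta> $ i * X i) \<le> x} X =
        (if 0 < X 1 \<and> 0 < X 2 \<and> 0 < X 3 \<and>
          \<theta> $ 1 * X 1 + \<theta> $ 2 * X 2 + \<theta> $ 3 * X 3 \<le> x then 1 else 0 :: ennreal)"
      using AE_PiM_gamma_pos[OF assms, of "1 :: 3" UNIV] AE_PiM_gamma_pos[OF assms, of "2 :: 3" UNIV]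
        AE_PiM_gamma_pos[OF assms, of "3 :: 3" UNIV]
      by (auto simp: sum_3 space_PiM elim!: eventually_elim2)
  qed
  also have "\<dots> = (\<integral>\<^sup>+X. \<integral>\<^sup>+t. (if 0 < X 1 \<and> 0 < X 2 \<and> 0 < t \<and>
      \<theta> $ 1 * X 1 + \<theta> $ 2 * X 2 + \<theta> $ 3 * t \<le> x then 1 else 0)
      \<partial>gamma_measure \<alpha> \<partial>(\<Pi>\<^sub>M i\<in>{1, 2 :: 3}. gamma_measure \<alpha>))"
    unfolding UNIV_3_insert
  proof (subst product_nn_integral_insert)
    have [measurable]: "Measurable.pred (\<Pi>\<^sub>M i\<in>insert 3 {1, 2 :: 3}. gamma_measure \<alpha>)
        (\<lambda>X :: 3 \<Rightarrow> real. 0 < X 1 \<and> 0 < X 2 \<and> 0 < X 3 \<and> \<theta> $ 1 * X 1 + \<theta> $ 2 * X 2 + \<theta> $ 3 * X 3 \<le> x)"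
      unfolding UNIV_3_insert[symmetric] by measurable
    show "(\<lambda>X :: 3 \<Rightarrow> real. if 0 < X 1 \<and> 0 < X 2 \<and> 0 < X 3 \<and>
        \<theta> $ 1 * X 1 + \<theta> $ 2 * X 2 + \<theta> $ 3 * X 3 \<le> x then 1 else 0 :: ennreal)
        \<in> borel_measurable (\<Pi>\<^sub>M i\<in>insert 3 {1, 2 :: 3}. gamma_measure \<alpha>)"
      by measurable
  qed simp_all
  finally show ?thesis .
qed

text \<open>Conditioning on the first two coordinates leaves a one-dimensional event for the third.
  This is the form to which the Taylor expansion of the gamma distribution function applies.\<close>

lemma weighted_gamma_cdf_3_expectation:
  fixes \<theta> :: "real ^ 3"
  assumes "0 < \<alpha>" "0 < \<theta> $ 3"
  shows "weighted_gamma_cdf \<alpha> \<theta> x =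
    (\<integral>X. cdf (gamma_measure \<alpha>) ((x - \<theta> $ 1 * X 1 - \<theta> $ 2 * X 2) / \<theta> $ 3)
      \<partial>(\<Pi>\<^sub>M i\<in>{1, 2 :: 3}. gamma_measure \<alpha>))" (is "_ = integral\<^sup>L ?P ?f")
proof -
  interpret real_distribution "gamma_measure \<alpha>"
    using assms(1) by (rule real_distribution_gamma_measure)
  have m [measurable]: "?f \<in> borel_measurable ?P"
    using assms(1) by measurable
  interpret P: prob_space ?P
    using assms(1) by (intro prob_space_PiM prob_space_gamma_measure)
  have AE: "AE X in ?P. 0 < X 1" "AE X in ?P. 0 < X 2"
    by (rule AE_PiM_gamma_pos[OF assms(1)], simp)+
  have "ennreal (weighted_gamma_cdf \<alpha> \<theta> x) = (\<integral>\<^sup>+X. ennreal (?f X) \<partial>?P)"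
    unfolding weighted_gamma_cdf_3_nn_integral[OF assms(1)]
  proof (rule nn_integral_cong_AE, use AE in eventually_elim)
    fix X :: "3 \<Rightarrow> real" assume X: "0 < X 1" "0 < X 2"
    have "(\<integral>\<^sup>+t. (if 0 < X 1 \<and> 0 < X 2 \<and> 0 < t \<and> \<theta> $ 1 * X 1 + \<theta> $ 2 * X 2 + \<theta> $ 3 * t \<le> x then 1 else 0)
        \<partial>gamma_measure \<alpha>) =
      (\<integral>\<^sup>+t. indicator {..(x - \<theta> $ 1 * X 1 - \<theta> $ 2 * X 2) / \<theta> $ 3} t \<partial>gamma_measure \<alpha>)"
    proof (rule nn_integral_cong_AE)
      show "AE t in gamma_measure \<alpha>. (if 0 < X 1 \<and> 0 < X 2 \<and> 0 < t \<and>
          \<theta> $ 1 * X 1 + \<theta> $ 2 * X 2 + \<theta> $ 3 * t \<le> x then 1 else 0 :: ennreal) =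
          indicator {..(x - \<theta> $ 1 * X 1 - \<theta> $ 2 * X 2) / \<theta> $ 3} t"
        using AE_gamma_measure_pos[of \<alpha>]
        by eventually_elim (use X assms(2) in \<open>auto simp: indicator_def field_simps\<close>)
    qed
    also have "\<dots> = ennreal (?f X)"
      by (simp add: cdf_def emeasure_eq_measure)
    finally show "(\<integral>\<^sup>+t. (if 0 < X 1 \<and> 0 < X 2 \<and> 0 < t \<and> \<theta> $ 1 * X 1 + \<theta> $ 2 * X 2 + \<theta> $ 3 * t \<le> x then 1 else 0)
        \<partial>gamma_measure \<alpha>) = ennreal (?f X)" .
  qed
  also have "\<dots> = ennreal (integral\<^sup>L ?P ?f)"
    by (intro nn_integral_eq_integral P.integrable_const_bound[of _ 1])
      (auto simp: cdf_nonneg cdf_bounded_prob)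
  finally show ?thesis
    by (subst (asm) ennreal_inj) (auto simp: weighted_gamma_cdf_eq_measure cdf_nonneg)
qed

section \<open>Comparison of the two distribution functions near 0\<close>

text \<open>
  For gamma-distributed \<open>T\<close>, the density of \<open>c T\<close> at \<open>s\<close> is \<open>c\<^bsup>-\<alpha>\<^esup> s\<^bsup>\<alpha>-1\<^esup> exp (- s / c) / \<Gamma>(\<alpha>)\<close>, so on \<open>s \<le> x\<close> the two densities differ
  essentially by the constant factor \<open>(a / b)\<^bsup>\<alpha>\<^esup>\<close>.
\<close>

lemma gamma_scaling_comparison:
  fixes f :: "real \<Rightarrow> ennreal"
  assumes "0 < \<alpha>" "0 < a" "0 < b" and [measurable]: "f \<in> borel_measurable borel"
    and supp: "\<And>s. x < s \<Longrightarrow> f s = 0"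
  shows "(\<integral>\<^sup>+t. f (b * t) \<partial>gamma_measure \<alpha>) \<le>
    ennreal ((a / b) powr \<alpha> * exp (x / a)) * (\<integral>\<^sup>+t. f (a * t) \<partial>gamma_measure \<alpha>)"
proof -
  have scale: "(\<integral>\<^sup>+t. f (c * t) \<partial>gamma_measure \<alpha>) = (\<integral>\<^sup>+s. f s * ennreal (gamma_density \<alpha> (s / c) / c) \<partial>lborel)"
    if "0 < c" for c
  proof -
    have "(\<integral>\<^sup>+s. f s * ennreal (gamma_density \<alpha> (s / c) / c) \<partial>lborel) =
        ennreal c * (\<integral>\<^sup>+t. f (c * t) * ennreal (gamma_density \<alpha> t / c) \<partial>lborel)"
      using that by (subst nn_integral_real_affine[of _ c 0]) auto
    also have "\<dots> = (\<integral>\<^sup>+t. ennreal (gamma_density \<alpha> t) * f (c * t) \<partial>lborel)"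
    proof (subst nn_integral_cmult[symmetric])
      have "ennreal c * (F * ennreal (gamma_density \<alpha> t / c)) = ennreal (gamma_density \<alpha> t) * F" for F t
      proof -
        have "ennreal c * ennreal (gamma_density \<alpha> t / c) = ennreal (gamma_density \<alpha> t)"
          using that assms(1) by (simp flip: ennreal_mult)
        then show ?thesis by (metis mult.assoc mult.commute)
      qed
      then show "(\<integral>\<^sup>+t. ennreal c * (f (c * t) * ennreal (gamma_density \<alpha> t / c)) \<partial>lborel) =
          (\<integral>\<^sup>+t. ennreal (gamma_density \<alpha> t) * f (c * t) \<partial>lborel)" by simp
    qed measurable
    finally show ?thesis
      by (simp add: gamma_measure_def nn_integral_density)
  qed
  have "gamma_density \<alpha> (s / b) / b \<le> (a / b) powr \<alpha> * exp (x / a) * (gamma_density \<alpha> (s / a) / a)"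
    if "s \<le> x" for s
  proof (cases "0 < s")
    case True
    have dens: "gamma_density \<alpha> (s / c) / c = s powr (\<alpha> - 1) / Gamma \<alpha> * (exp (- (s / c)) / c powr \<alpha>)"
      if "0 < c" for c
      using that True by (simp add: gamma_density_def powr_divide powr_diff)
    \<comment> \<open>For 0 < s \<le> x the left exponent is at most 0 and the right one at least
      0.\<close>
    have "exp (- (s / b)) \<le> exp (x / a - s / a)"
      using True that assms by (auto simp: divide_right_mono intro: order_trans[of _ 0])
    then have "exp (- (s / b)) / b powr \<alpha> \<le> exp (x / a - s / a) / b powr \<alpha>"
      by (rule divide_right_mono) simp
    also have "\<dots> = (a / b) powr \<alpha> * exp (x / a) * (exp (- (s / a)) / a powr \<alpha>)"
      using assms by (simp add: powr_divide exp_diff exp_minus) (simp add: field_simps)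
    finally have "s powr (\<alpha> - 1) / Gamma \<alpha> * (exp (- (s / b)) / b powr \<alpha>) \<le>
        s powr (\<alpha> - 1) / Gamma \<alpha> * ((a / b) powr \<alpha> * exp (x / a) * (exp (- (s / a)) / a powr \<alpha>))"
      using Gamma_real_pos[OF assms(1)] by (intro mult_left_mono) auto
    then show ?thesis
      unfolding dens[OF assms(2)] dens[OF assms(3)] by (metis mult.left_commute)
  qed (use assms in \<open>simp add: gamma_density_def divide_less_0_iff zero_less_divide_iff\<close>)
  then have "(\<integral>\<^sup>+s. f s * ennreal (gamma_density \<alpha> (s / b) / b) \<partial>lborel) \<le>
      (\<integral>\<^sup>+s. ennreal ((a / b) powr \<alpha> * exp (x / a)) * (f s * ennreal (gamma_density \<alpha> (s / a) / a)) \<partial>lborel)"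
  proof (intro nn_integral_mono)
    fix s
    assume *: "\<And>s. s \<le> x \<Longrightarrow> gamma_density \<alpha> (s / b) / b \<le>
      (a / b) powr \<alpha> * exp (x / a) * (gamma_density \<alpha> (s / a) / a)"
    show "f s * ennreal (gamma_density \<alpha> (s / b) / b) \<le>
        ennreal ((a / b) powr \<alpha> * exp (x / a)) * (f s * ennreal (gamma_density \<alpha> (s / a) / a))"
    proof (cases "s \<le> x")
      case True
      have "ennreal (gamma_density \<alpha> (s / b) / b) \<le>
          ennreal ((a / b) powr \<alpha> * exp (x / a)) * ennreal (gamma_density \<alpha> (s / a) / a)"
        using *[OF True] by (simp add: ennreal_mult'[symmetric] ennreal_leI)
      then have "f s * ennreal (gamma_density \<alpha> (s / b) / b) \<le>
          f s * (ennreal ((a / b) powr \<alpha> * exp (x / a)) * ennreal (gamma_density \<alpha> (s / a) / a))"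
        by (intro mult_left_mono) auto
      then show ?thesis by (simp only: mult.left_commute)
    qed (use supp in simp)
  qed
  then show ?thesis
    unfolding scale[OF assms(2)] scale[OF assms(3)] by (subst (asm) nn_integral_cmult) simp_all
qed

text \<open>The positivity conditions make the function vanish as soon as a single argument exceeds
  \<open>x\<close>, which is the support condition of
  \<open>gamma_scaling_comparison\<close>.\<close>

definition simplex_indicator :: "real \<Rightarrow> real \<Rightarrow> real \<Rightarrow> real \<Rightarrow> ennreal" where
  "simplex_indicator x r s t = (if 0 < r \<and> 0 < s \<and> 0 < t \<and> r + s + t \<le> x then 1 else 0)"

lemma simplex_indicator_measurable [measurable (raw)]:
  assumes [measurable]: "f \<in> borel_measurable M" "g \<in> borel_measurable M" "h \<in> borel_measurable M"
  shows "(\<lambda>w. simplex_indicator x (f w) (g w) (h w)) \<in> borel_measurable M"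
  unfolding simplex_indicator_def by measurable

text \<open>With three separate integrals the weights can be exchanged one at a time. Positive
  weights allow the sign conditions to be stated for the scaled coordinates.\<close>

lemma weighted_gamma_cdf_3_iterated:
  fixes \<theta> :: "real ^ 3"
  assumes "0 < \<alpha>" "\<And>i. 0 < \<theta> $ i"
  shows "ennreal (weighted_gamma_cdf \<alpha> \<theta> x) =
    (\<integral>\<^sup>+r. \<integral>\<^sup>+s. \<integral>\<^sup>+t. simplex_indicator x (\<theta> $ 1 * r) (\<theta> $ 2 * s) (\<theta> $ 3 * t)
      \<partial>gamma_measure \<alpha> \<partial>gamma_measure \<alpha> \<partial>gamma_measure \<alpha>)"
proof -
  interpret product_prob_space "\<lambda>_ :: 3. gamma_measure \<alpha>" UNIV
    using assms(1) by (rule product_prob_space_gamma)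
  have pos: "0 < \<theta> $ i * r \<longleftrightarrow> 0 < r" for i r
    using assms(2)[of i] by (simp add: zero_less_mult_iff)
  let ?k = "\<lambda>r s. \<integral>\<^sup>+t. simplex_indicator x (\<theta> $ 1 * r) (\<theta> $ 2 * s) (\<theta> $ 3 * t) \<partial>gamma_measure \<alpha>"
  have k [measurable]: "(\<lambda>p. ?k (fst p) (snd p)) \<in> borel_measurable (gamma_measure \<alpha> \<Otimes>\<^sub>M gamma_measure \<alpha>)"
    by measurable
  have "ennreal (weighted_gamma_cdf \<alpha> \<theta> x) =
      (\<integral>\<^sup>+X. ?k (X 1) (X 2) \<partial>(\<Pi>\<^sub>M i\<in>{1, 2 :: 3}. gamma_measure \<alpha>))"
    unfolding weighted_gamma_cdf_3_nn_integral[OF assms(1)] simplex_indicator_def pos ..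
  also have "\<dots> = (\<integral>\<^sup>+p. ?k (fst p) (snd p) \<partial>(gamma_measure \<alpha> \<Otimes>\<^sub>M gamma_measure \<alpha>))"
    using k by (intro product_nn_integral_pair) (simp_all add: case_prod_unfold)
  also have "\<dots> = (\<integral>\<^sup>+r. \<integral>\<^sup>+s. ?k r s \<partial>gamma_measure \<alpha> \<partial>gamma_measure \<alpha>)"
    using sigma_finite_measure.nn_integral_fst[OF _ k] assms(1)
    by (simp add: prob_space_gamma_measure prob_space_imp_sigma_finite)
  finally show ?thesis .
qed

text \<open>Each \<eta> weight is replaced by the corresponding \<theta> weight, from the innermost
  integral outwards. Each replacement is one use of the scaling comparison and costs one factor of
  the product.\<close>

lemma weighted_gamma_cdf_comparison:
  fixes \<theta> \<eta> :: "real ^ 3"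
  assumes "0 < \<alpha>" "\<And>i. 0 < \<theta> $ i" "\<And>i. 0 < \<eta> $ i"
  shows "weighted_gamma_cdf \<alpha> \<eta> x \<le>
    (\<Prod>i\<in>UNIV. (\<theta> $ i / \<eta> $ i) powr \<alpha> * exp (x / \<theta> $ i)) * weighted_gamma_cdf \<alpha> \<theta> x"
proof -
  interpret G: sigma_finite_measure "gamma_measure \<alpha>"
    using assms(1) by (simp add: prob_space_gamma_measure prob_space_imp_sigma_finite)
  let ?G = "gamma_measure \<alpha>" and ?h = "simplex_indicator x"
  define C where "C i = (\<theta> $ i / \<eta> $ i) powr \<alpha> * exp (x / \<theta> $ i)" for i
  have C: "0 \<le> C i" for i by (simp add: C_def)
  have compare: "(\<integral>\<^sup>+t. f (\<eta> $ i * t) \<partial>?G) \<le> ennreal (C i) * (\<integral>\<^sup>+t. f (\<theta> $ i * t) \<partial>?G)"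
    if "f \<in> borel_measurable borel" "\<And>s. x < s \<Longrightarrow> f s = 0" for f i
    unfolding C_def using assms that by (intro gamma_scaling_comparison)
  have zero: "?h r s t = 0" if "x < r \<or> x < s \<or> x < t" for r s t
    using that by (auto simp: simplex_indicator_def)
  have "(\<integral>\<^sup>+r. \<integral>\<^sup>+s. \<integral>\<^sup>+t. ?h (\<eta> $ 1 * r) (\<eta> $ 2 * s) (\<eta> $ 3 * t) \<partial>?G \<partial>?G \<partial>?G) \<le>
      (\<integral>\<^sup>+r. \<integral>\<^sup>+s. ennreal (C 3) * (\<integral>\<^sup>+t. ?h (\<eta> $ 1 * r) (\<eta> $ 2 * s) (\<theta> $ 3 * t) \<partial>?G) \<partial>?G \<partial>?G)"
    by (intro nn_integral_mono compare) (measurable, simp add: zero)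
  also have "\<dots> \<le> (\<integral>\<^sup>+r. ennreal (C 3) * (\<integral>\<^sup>+s. \<integral>\<^sup>+t. ?h (\<eta> $ 1 * r) (\<eta> $ 2 * s) (\<theta> $ 3 * t) \<partial>?G \<partial>?G) \<partial>?G)"
    by (simp add: nn_integral_cmult)
  also have "\<dots> \<le> (\<integral>\<^sup>+r. ennreal (C 3) * (ennreal (C 2) *
      (\<integral>\<^sup>+s. \<integral>\<^sup>+t. ?h (\<eta> $ 1 * r) (\<theta> $ 2 * s) (\<theta> $ 3 * t) \<partial>?G \<partial>?G)) \<partial>?G)"
    by (intro nn_integral_mono mult_left_mono
        compare[where f = "\<lambda>s. \<integral>\<^sup>+t. ?h (\<eta> $ 1 * r) s (\<theta> $ 3 * t) \<partial>?G" for r]) (measurable, simp_all add: zero)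
  also have "\<dots> = ennreal (C 3) * (ennreal (C 2) *
      (\<integral>\<^sup>+r. \<integral>\<^sup>+s. \<integral>\<^sup>+t. ?h (\<eta> $ 1 * r) (\<theta> $ 2 * s) (\<theta> $ 3 * t) \<partial>?G \<partial>?G \<partial>?G))"
    by (simp add: nn_integral_cmult)
  also have "\<dots> \<le> ennreal (C 3) * (ennreal (C 2) * (ennreal (C 1) *
      (\<integral>\<^sup>+r. \<integral>\<^sup>+s. \<integral>\<^sup>+t. ?h (\<theta> $ 1 * r) (\<theta> $ 2 * s) (\<theta> $ 3 * t) \<partial>?G \<partial>?G \<partial>?G)))"
    by (intro mult_left_mono
        compare[where f = "\<lambda>r. \<integral>\<^sup>+s. \<integral>\<^sup>+t. ?h r (\<theta> $ 2 * s) (\<theta> $ 3 * t) \<partial>?G \<partial>?G"]) (measurable, simp_all add: zero)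
  finally have "ennreal (weighted_gamma_cdf \<alpha> \<eta> x) \<le>
      ennreal (C 3) * (ennreal (C 2) * (ennreal (C 1) * ennreal (weighted_gamma_cdf \<alpha> \<theta> x)))"
    using assms by (simp add: weighted_gamma_cdf_3_iterated)
  also have "\<dots> = ennreal ((\<Prod>i\<in>UNIV. C i) * weighted_gamma_cdf \<alpha> \<theta> x)"
  proof -
    have "(\<Prod>i\<in>UNIV. C i) = C 3 * (C 2 * C 1)"
      unfolding UNIV_3_insert by simp
    then show ?thesis
      using C by (simp add: ennreal_mult' mult.assoc)
  qed
  finally show ?thesis
    using C by (subst (asm) ennreal_le_iff)
      (auto simp: weighted_gamma_cdf_eq_measure C_def intro!: mult_nonneg_nonneg prod_nonneg)
qed

text \<open>As \<open>x\<close> tends to 0 the exponential factors tend to 1, so the comparison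
  constant tends to the ratio of the two products raised to the power \<alpha>, which is below
  1.\<close>

lemma weighted_gamma_cdf_less_near_zero:
  fixes \<theta> \<eta> :: "real ^ 3"
  assumes "0 < \<alpha>" "\<And>i. 0 < \<theta> $ i" "\<And>i. 0 < \<eta> $ i"
    and prod: "(\<Prod>i\<in>UNIV. \<theta> $ i) < (\<Prod>i\<in>UNIV. \<eta> $ i)"
  shows "\<forall>\<^sub>F x in at_right 0. weighted_gamma_cdf \<alpha> \<eta> x < weighted_gamma_cdf \<alpha> \<theta> x"
proof -
  let ?C = "\<lambda>x. \<Prod>i\<in>UNIV. (\<theta> $ i / \<eta> $ i) powr \<alpha> * exp (x / \<theta> $ i)"
  have "(?C \<longlongrightarrow> (\<Prod>i\<in>UNIV. (\<theta> $ i / \<eta> $ i) powr \<alpha> * exp (0 / \<theta> $ i))) (at_right 0)"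
    using assms(2) by (intro tendsto_intros) (auto simp: less_imp_neq[symmetric])
  moreover have "(\<Prod>i\<in>UNIV. (\<theta> $ i / \<eta> $ i) powr \<alpha> * exp (0 / \<theta> $ i)) =
      ((\<Prod>i\<in>UNIV. \<theta> $ i) / (\<Prod>i\<in>UNIV. \<eta> $ i)) powr \<alpha>"
    using assms(2,3) by (simp add: powr_divide less_imp_le prod_nonneg prod_dividef prod_powr_distrib)
  moreover have "\<dots> < 1 powr \<alpha>"
  proof (rule powr_less_mono2)
    have "0 < (\<Prod>i\<in>UNIV. \<theta> $ i)" "0 < (\<Prod>i\<in>UNIV. \<eta> $ i)"
      using assms(2,3) by (auto intro!: prod_pos)
    then show "0 \<le> (\<Prod>i\<in>UNIV. \<theta> $ i) / (\<Prod>i\<in>UNIV. \<eta> $ i)"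
        "(\<Prod>i\<in>UNIV. \<theta> $ i) / (\<Prod>i\<in>UNIV. \<eta> $ i) < 1"
      using prod by simp_all
  qed (use assms in simp)
  ultimately have "\<forall>\<^sub>F x in at_right 0. ?C x < 1"
    by (auto dest: order_tendstoD)
  moreover have "\<forall>\<^sub>F x :: real in at_right 0. 0 < x"
    by (simp add: eventually_at_right_less)
  ultimately show ?thesis
  proof eventually_elim
    case (elim x)
    have "weighted_gamma_cdf \<alpha> \<eta> x \<le> ?C x * weighted_gamma_cdf \<alpha> \<theta> x"
      by (rule weighted_gamma_cdf_comparison) (use assms in auto)
    also have "\<dots> < 1 * weighted_gamma_cdf \<alpha> \<theta> x"
      using elim assms by (intro mult_strict_right_mono weighted_gamma_cdf_pos) auto
    finally show ?case by simp
  qed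
qed

section \<open>Second-order expansion in the small weights and the limit of the scaled
  difference\<close>

lemma gamma_pair_moment:
  fixes a b :: 'i
  assumes "0 < \<alpha>" "a \<noteq> b"
  shows "has_bochner_integral (\<Pi>\<^sub>M i\<in>{a, b}. gamma_measure \<alpha>) (\<lambda>X. X a ^ j * X b ^ k)
    (pochhammer \<alpha> j * pochhammer \<alpha> k)"
proof -
  interpret product_prob_space "\<lambda>_ :: 'i. gamma_measure \<alpha>" "{a, b}"
    using assms(1) by (rule product_prob_space_gamma)
  let ?f = "\<lambda>i t. t ^ (if i = a then j else k) :: real"
  have int: "integrable (gamma_measure \<alpha>) (\<lambda>t. t ^ n)"
      "integral\<^sup>L (gamma_measure \<alpha>) (\<lambda>t. t ^ n) = pochhammer \<alpha> n" for n
    using gamma_moment[OF assms(1), of n] by (simp_all add: has_bochner_integral_iff)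
  show ?thesis
    using product_integrable_prod[of "{a, b}" ?f] product_integral_prod[of "{a, b}" ?f] int assms(2)
    by (simp add: has_bochner_integral_iff)
qed

text \<open>The Taylor polynomial is integrated term by term at S = p X_a + q X_b. The independent
  summands have mean and variance \<alpha>, which gives the first and second moments of S in the
  formula; the remainder is controlled by a third moment.\<close>

lemma gamma_pair_expansion:
  fixes a b :: 'i
  assumes "0 < \<alpha>" "0 < l" "a \<noteq> b"
  shows "\<exists>K\<ge>0. \<forall>y\<in>{l..u}. \<forall>p\<ge>0. \<forall>q\<ge>0.
    \<bar>(\<integral>X. cdf (gamma_measure \<alpha>) (y - p * X a - q * X b) \<partial>(\<Pi>\<^sub>M i\<in>{a, b}. gamma_measure \<alpha>)) -
      (cdf (gamma_measure \<alpha>) y - gamma_density \<alpha> y * (\<alpha> * (p + q)) +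
       gamma_density \<alpha> y * ((\<alpha> - 1) / y - 1) / 2 * (\<alpha>\<^sup>2 * (p + q)\<^sup>2 + \<alpha> * (p\<^sup>2 + q\<^sup>2)))\<bar>
    \<le> K * (p + q) ^ 3"
proof -
  let ?P = "\<Pi>\<^sub>M i\<in>{a, b}. gamma_measure \<alpha>" and ?G = "cdf (gamma_measure \<alpha>)"
  let ?g = "gamma_density \<alpha>" and ?g' = "\<lambda>y. gamma_density \<alpha> y * ((\<alpha> - 1) / y - 1)"
  interpret real_distribution "gamma_measure \<alpha>"
    using assms(1) by (rule real_distribution_gamma_measure)
  interpret P: prob_space ?P
    using assms(1) by (intro prob_space_PiM prob_space_gamma_measure)
  have "\<exists>K\<ge>0. \<forall>y\<in>{l..u}. \<forall>s\<ge>0. \<bar>?G (y - s) - (?G y - ?g y * s + ?g' y / 2 * s\<^sup>2)\<bar> \<le> K * s ^ 3"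
  proof (rule taylor_remainder_half_line)
    show "\<bar>?G y\<bar> \<le> 1" for y using cdf_nonneg[of y] cdf_bounded_prob[of y] by simp
    show "continuous_on {0<..} (\<lambda>x. ?g x * (((\<alpha> - 1) / x - 1)\<^sup>2 - (\<alpha> - 1) / x\<^sup>2))"
      by (intro continuous_intros continuous_on_gamma_density) auto
  qed (use assms in \<open>simp_all add: gamma_cdf_has_derivative gamma_density_has_derivative
      gamma_density_has_second_derivative\<close>)
  then obtain K where K: "0 \<le> K"
    "\<And>y s. y \<in> {l..u} \<Longrightarrow> 0 \<le> s \<Longrightarrow> \<bar>?G (y - s) - (?G y - ?g y * s + ?g' y / 2 * s\<^sup>2)\<bar> \<le> K * s ^ 3"
    by blast
  have mom: "integrable ?P (\<lambda>X. X a ^ j * X b ^ k)"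
      "integral\<^sup>L ?P (\<lambda>X. X a ^ j * X b ^ k) = pochhammer \<alpha> j * pochhammer \<alpha> k" for j k
    using gamma_pair_moment[OF assms(1,3), of j k] by (simp_all add: has_bochner_integral_iff)
  have AE: "AE X in ?P. 0 < X a" "AE X in ?P. 0 < X b"
    by (rule AE_PiM_gamma_pos[OF assms(1)], simp)+
  \<comment> \<open>The binomial expansion of the cube reduces integrability to mixed
    moments.\<close>
  have "integrable ?P (\<lambda>X. X a ^ 3 + 3 * (X a ^ 2 * X b ^ 1) + 3 * (X a ^ 1 * X b ^ 2) + X b ^ 3)"
    using mom(1)[of 3 0] mom(1)[of 0 3] mom(1)[of 2 1] mom(1)[of 1 2] by (simp del: power_one_right)
  then have int3: "integrable ?P (\<lambda>X. (X a + X b) ^ 3)"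
    by (rule back_subst[of "integrable ?P"]) (auto simp: power3_eq_cube power2_eq_square algebra_simps)
  define M where "M = integral\<^sup>L ?P (\<lambda>X. (X a + X b) ^ 3)"
  have M: "0 \<le> M"
    unfolding M_def by (rule integral_nonneg_AE) (use AE in eventually_elim, simp)
  have "\<bar>(\<integral>X. ?G (y - p * X a - q * X b) \<partial>?P) -
      (?G y - ?g y * (\<alpha> * (p + q)) + ?g' y / 2 * (\<alpha>\<^sup>2 * (p + q)\<^sup>2 + \<alpha> * (p\<^sup>2 + q\<^sup>2)))\<bar>
      \<le> K * M * (p + q) ^ 3" if y: "y \<in> {l..u}" and pq: "0 \<le> p" "0 \<le> q" for y p q
  proof -
    define S where "S X = p * X a + q * X b" for X :: "'i \<Rightarrow> real"
    have S1: "has_bochner_integral ?P S (\<alpha> * (p + q))"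
      using mom[of 1 0] mom[of 0 1] unfolding S_def
      by (simp add: has_bochner_integral_iff algebra_simps)
    have "has_bochner_integral ?P (\<lambda>X. p\<^sup>2 * (X a ^ 2 * X b ^ 0) + 2 * p * q * (X a ^ 1 * X b ^ 1) + q\<^sup>2 * (X a ^ 0 * X b ^ 2))
        (p\<^sup>2 * (\<alpha> * (\<alpha> + 1)) + 2 * p * q * (\<alpha> * \<alpha>) + q\<^sup>2 * (\<alpha> * (\<alpha> + 1)))"
      using mom[of 2 0] mom[of 0 2] mom[of 1 1]
      by (simp add: has_bochner_integral_iff numeral_2_eq_2 pochhammer_Suc)
    then have S2: "has_bochner_integral ?P (\<lambda>X. (S X)\<^sup>2) (\<alpha>\<^sup>2 * (p + q)\<^sup>2 + \<alpha> * (p\<^sup>2 + q\<^sup>2))"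
      by (rule back_subst[of "\<lambda>(f, v). has_bochner_integral ?P f v", of "(_, _)" "(_, _)", simplified])
        (auto simp: S_def power2_eq_square algebra_simps)
    have G: "integrable ?P (\<lambda>X. ?G (y - S X))"
      using assms(1) unfolding S_def
      by (intro P.integrable_const_bound[of _ 1]) (auto simp: cdf_nonneg cdf_bounded_prob)
    have R: "has_bochner_integral ?P (\<lambda>X. ?G (y - S X) - (?G y - ?g y * S X + ?g' y / 2 * (S X)\<^sup>2))
        ((\<integral>X. ?G (y - S X) \<partial>?P) -
          (?G y - ?g y * (\<alpha> * (p + q)) + ?g' y / 2 * (\<alpha>\<^sup>2 * (p + q)\<^sup>2 + \<alpha> * (p\<^sup>2 + q\<^sup>2))))"
      using S1 S2 G by (simp add: has_bochner_integral_iff P.prob_space)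
    have "\<bar>\<integral>X. ?G (y - S X) - (?G y - ?g y * S X + ?g' y / 2 * (S X)\<^sup>2) \<partial>?P\<bar>
        \<le> (\<integral>X. \<bar>?G (y - S X) - (?G y - ?g y * S X + ?g' y / 2 * (S X)\<^sup>2)\<bar> \<partial>?P)"
      by (rule integral_abs_bound)
    also have "\<dots> \<le> (\<integral>X. K * (p + q) ^ 3 * (X a + X b) ^ 3 \<partial>?P)"
    proof (rule integral_mono_AE)
      show "integrable ?P (\<lambda>X. \<bar>?G (y - S X) - (?G y - ?g y * S X + ?g' y / 2 * (S X)\<^sup>2)\<bar>)"
        using R by (intro integrable_abs) (simp add: has_bochner_integral_iff)
      show "integrable ?P (\<lambda>X. K * (p + q) ^ 3 * (X a + X b) ^ 3)"
        using int3 by simp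
      show "AE X in ?P. \<bar>?G (y - S X) - (?G y - ?g y * S X + ?g' y / 2 * (S X)\<^sup>2)\<bar>
          \<le> K * (p + q) ^ 3 * (X a + X b) ^ 3"
        using AE
      proof eventually_elim
        case (elim X)
        \<comment> \<open>This bound separates the weights from the random variables, so the single
          moment \<open>M\<close> serves all \<open>p\<close> and \<open>q\<close>.\<close>
        have S: "0 \<le> S X" "S X \<le> (p + q) * (X a + X b)"
          using elim pq by (auto simp: S_def algebra_simps)
        have "\<bar>?G (y - S X) - (?G y - ?g y * S X + ?g' y / 2 * (S X)\<^sup>2)\<bar> \<le> K * S X ^ 3"
          using K(2)[OF y S(1)] .
        also have "\<dots> \<le> K * ((p + q) * (X a + X b)) ^ 3"
          using S K(1) by (intro mult_left_mono power_mono)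
        finally show ?case by (simp add: power_mult_distrib mult_ac)
      qed
    qed
    also have "\<dots> = K * M * (p + q) ^ 3" by (simp add: M_def)
    finally show ?thesis using R by (simp add: has_bochner_integral_iff S_def diff_diff_eq)
  qed
  then show ?thesis using K(1) M by (intro exI[of _ "K * M"]) auto
qed

text \<open>
  The entries sum to \<open>1 + 2\<delta>\<close>; the scale factor \<open>1 + \<kappa>\<close> in the first entry makes
  \<open>\<theta> / (1 + \<kappa>)\<close> have entries \<open>\<delta> / 2\<close>, \<open>u - \<delta> / 2\<close>, \<open>1\<close>.
\<close>

definition spread_vector :: "real \<Rightarrow> real \<Rightarrow> real ^ 3" where
  "spread_vector \<alpha> \<delta> =
    (let \<kappa> = \<delta>\<^sup>2 / \<alpha> in vector [(1 + \<kappa>) * (\<delta> / 2), 2 * \<delta> - \<kappa> - (1 + \<kappa>) * (\<delta> / 2), 1 + \<kappa>])"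

definition balanced_vector :: "real \<Rightarrow> real ^ 3" where
  "balanced_vector \<delta> = vector [\<delta>, \<delta>, 1]"

text \<open>Both distribution functions are values of one expectation \<open>E\<close>, and its
  Taylor polynomial \<open>T\<close> carries the limit. With density g at \<open>x\<close>, the
  terms of order 0, 1 and 2 contribute g x / \<alpha>, - g and - (\<alpha> / 4) g'; the remainders
  are of order \<delta>^3.\<close>

lemma cdf_difference_limit:
  assumes "0 < \<alpha>" "0 < x"
  defines "L \<equiv> gamma_density \<alpha> x * (x / \<alpha> - 1 + \<alpha> / 4 * (1 + (1 - \<alpha>) / x))"
  shows "((\<lambda>\<delta>. (weighted_gamma_cdf \<alpha> (balanced_vector \<delta>) x - weighted_gamma_cdf \<alpha> (spread_vector \<alpha> \<delta>) x) / \<delta>\<^sup>2)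
    \<longlongrightarrow> L) (at_right 0)"
proof -
  let ?G = "cdf (gamma_measure \<alpha>)" and ?g = "gamma_density \<alpha>"
  define g' where "g' y = ?g y * ((\<alpha> - 1) / y - 1)" for y
  define E where "E p q y = (\<integral>X. ?G (y - p * X 1 - q * X 2) \<partial>(\<Pi>\<^sub>M i\<in>{1, 2 :: 3}. gamma_measure \<alpha>))"
    for p q y :: real
  define T where "T p q y = ?G y - ?g y * (\<alpha> * (p + q)) +
    g' y / 2 * (\<alpha>\<^sup>2 * (p + q)\<^sup>2 + \<alpha> * (p\<^sup>2 + q\<^sup>2))" for p q y :: real
  define \<kappa> where "\<kappa> \<delta> = \<delta>\<^sup>2 / \<alpha>" for \<delta>
  \<comment> \<open>Dividing the spread vector by its third entry 1 + \<kappa> moves the base point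
    from \<open>x\<close> to \<open>y \<delta>\<close>; \<open>u \<delta>\<close> is the sum of the
    two small entries after this division.\<close>
  define y where "y \<delta> = x / (1 + \<kappa> \<delta>)" for \<delta>
  define u where "u \<delta> = (2 * \<delta> - \<kappa> \<delta>) / (1 + \<kappa> \<delta>)" for \<delta>
  define R where "R \<delta> = (E \<delta> \<delta> x - T \<delta> \<delta> x) - (E (\<delta> / 2) (u \<delta> - \<delta> / 2) (y \<delta>) - T (\<delta> / 2) (u \<delta> - \<delta> / 2) (y \<delta>))" for \<delta>
  have \<kappa>_nonneg: "0 \<le> \<kappa> \<delta>" for \<delta> using assms(1) by (simp add: \<kappa>_def)
  then have \<kappa>_nz: "1 + \<kappa> \<delta> \<noteq> 0" for \<delta> using add_pos_nonneg[of 1 "\<kappa> \<delta>"] by (metis less_irrefl zero_less_one)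
  have pos: "\<forall>\<^sub>F \<delta> :: real in at_right 0. 0 < \<delta>"
    by (simp add: eventually_at_right_less)

  have weighted_balanced: "weighted_gamma_cdf \<alpha> (balanced_vector \<delta>) x = E \<delta> \<delta> x" for \<delta>
    using assms(1) by (subst weighted_gamma_cdf_3_expectation) (simp_all add: balanced_vector_def E_def)
  have weighted_spread: "weighted_gamma_cdf \<alpha> (spread_vector \<alpha> \<delta>) x = E (\<delta> / 2) (u \<delta> - \<delta> / 2) (y \<delta>)" for \<delta>
  proof -
    have "(x - (1 + \<kappa> \<delta>) * (\<delta> / 2) * r - (2 * \<delta> - \<kappa> \<delta> - (1 + \<kappa> \<delta>) * (\<delta> / 2)) * s) / (1 + \<kappa> \<delta>) =
        y \<delta> - \<delta> / 2 * r - (u \<delta> - \<delta> / 2) * s" for r s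
    proof -
      have "x = y \<delta> * (1 + \<kappa> \<delta>)" "2 * \<delta> - \<kappa> \<delta> = u \<delta> * (1 + \<kappa> \<delta>)"
        using \<kappa>_nz[of \<delta>] by (simp_all add: y_def u_def)
      then have "x - (1 + \<kappa> \<delta>) * (\<delta> / 2) * r - (2 * \<delta> - \<kappa> \<delta> - (1 + \<kappa> \<delta>) * (\<delta> / 2)) * s =
          (y \<delta> - \<delta> / 2 * r - (u \<delta> - \<delta> / 2) * s) * (1 + \<kappa> \<delta>)"
        by (simp only:) (simp add: algebra_simps)
      then show ?thesis
        using \<kappa>_nz[of \<delta>] by (simp add: nonzero_divide_eq_eq)
    qed
    then show ?thesis
      using assms(1) \<kappa>_nonneg[of \<delta>] unfolding E_def
      by (subst weighted_gamma_cdf_3_expectation)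
        (simp_all add: spread_vector_def Let_def \<kappa>_def[symmetric] add_pos_nonneg)
  qed

  have \<kappa>0: "(\<kappa> \<longlongrightarrow> 0) (at_right 0)"
    unfolding \<kappa>_def using assms(1) by (auto intro!: tendsto_eq_intros)
  have y_lim: "(y \<longlongrightarrow> x) (at_right 0)"
    unfolding y_def by (rule tendsto_eq_intros \<kappa>0 | simp)+
  \<comment> \<open>The transfer to the large entry lowers the total small weight by \<delta>^2 /
    \<alpha> to leading order.\<close>
  have u_eq: "(u \<delta> - 2 * \<delta>) / \<delta>\<^sup>2 = - (1 / \<alpha>) * ((1 + 2 * \<delta>) / (1 + \<kappa> \<delta>))" if "0 < \<delta>" for \<delta>
  proof -
    have "u \<delta> - 2 * \<delta> = - \<kappa> \<delta> * ((1 + 2 * \<delta>) / (1 + \<kappa> \<delta>))"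
      using \<kappa>_nz[of \<delta>] by (simp add: u_def field_simps)
    then show ?thesis using that assms(1) by (simp add: \<kappa>_def)
  qed
  have u2_lim: "((\<lambda>\<delta>. (u \<delta> - 2 * \<delta>) / \<delta>\<^sup>2) \<longlongrightarrow> - (1 / \<alpha>)) (at_right 0)"
  proof (rule Lim_transform_eventually)
    show "((\<lambda>\<delta>. - (1 / \<alpha>) * ((1 + 2 * \<delta>) / (1 + \<kappa> \<delta>))) \<longlongrightarrow> - (1 / \<alpha>)) (at_right 0)"
      by (rule tendsto_eq_intros \<kappa>0 | simp)+
    show "\<forall>\<^sub>F \<delta> in at_right 0. - (1 / \<alpha>) * ((1 + 2 * \<delta>) / (1 + \<kappa> \<delta>)) = (u \<delta> - 2 * \<delta>) / \<delta>\<^sup>2"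
      using pos by eventually_elim (simp add: u_eq)
  qed
  have u1_lim: "((\<lambda>\<delta>. u \<delta> / \<delta>) \<longlongrightarrow> 2) (at_right 0)"
  proof (rule Lim_transform_eventually)
    show "((\<lambda>\<delta>. (u \<delta> - 2 * \<delta>) / \<delta>\<^sup>2 * \<delta> + 2) \<longlongrightarrow> 2) (at_right 0)"
      by (rule tendsto_eq_intros u2_lim | simp)+
    show "\<forall>\<^sub>F \<delta> in at_right 0. (u \<delta> - 2 * \<delta>) / \<delta>\<^sup>2 * \<delta> + 2 = u \<delta> / \<delta>"
      using pos by eventually_elim (simp add: field_simps power2_eq_square)
  qed

  \<comment> \<open>As a function of s = \<delta>^2 the base point is x / (1 + s / \<alpha>), with
    derivative - x / \<alpha> at 0; the chain rule gives the limit.\<close>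
  have quotient_lim: "((\<lambda>\<delta>. (f (y \<delta>) - f x) / \<delta>\<^sup>2) \<longlongrightarrow> - (d * x / \<alpha>)) (at_right 0)"
    if "(f has_real_derivative d) (at x)" for f d
  proof -
    have "((\<lambda>s. f (x / (1 + s / \<alpha>))) has_real_derivative d * (- x * (1 / \<alpha>) / (1 + 0 / \<alpha>)\<^sup>2)) (at 0)"
      by (rule DERIV_chain2[where g = "\<lambda>s. x / (1 + s / \<alpha>)"])
        (use that assms(1) in \<open>auto intro!: derivative_eq_intros simp: power2_eq_square\<close>)
    then have "((\<lambda>s. (f (x / (1 + s / \<alpha>)) - f x) / s) \<longlongrightarrow> - (d * x / \<alpha>)) (at 0)"
      by (simp add: has_field_derivative_iff)
    moreover have "filterlim (\<lambda>\<delta> :: real. \<delta>\<^sup>2) (at 0) (at_right 0)"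
      unfolding filterlim_at by (auto intro!: tendsto_eq_intros eventually_mono[OF pos])
    ultimately show ?thesis
      unfolding y_def \<kappa>_def by (rule filterlim_compose)
  qed
  have G_lim: "((\<lambda>\<delta>. (?G (y \<delta>) - ?G x) / \<delta>\<^sup>2) \<longlongrightarrow> - (?g x * x / \<alpha>)) (at_right 0)"
    using assms by (intro quotient_lim gamma_cdf_has_derivative)
  have g_deriv: "(?g has_real_derivative g' x) (at x)"
    unfolding g'_def using assms by (intro gamma_density_has_derivative)
  have g_lim: "((\<lambda>\<delta>. (?g (y \<delta>) - ?g x) / \<delta>\<^sup>2) \<longlongrightarrow> - (g' x * x / \<alpha>)) (at_right 0)"
    by (rule quotient_lim[OF g_deriv])
  have gy: "((\<lambda>\<delta>. ?g (y \<delta>)) \<longlongrightarrow> ?g x) (at_right 0)"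
    using DERIV_isCont[OF g_deriv] y_lim by (rule isCont_tendsto_compose)
  have g'y: "((\<lambda>\<delta>. g' (y \<delta>)) \<longlongrightarrow> g' x) (at_right 0)"
    unfolding g'_def using assms by (intro tendsto_intros gy y_lim) auto

  have main: "((\<lambda>\<delta>. (T \<delta> \<delta> x - T (\<delta> / 2) (u \<delta> - \<delta> / 2) (y \<delta>)) / \<delta>\<^sup>2) \<longlongrightarrow> L) (at_right 0)"
  proof (rule Lim_transform_eventually)
    \<comment> \<open>The three groups are the Taylor terms of order 0, 1 and 2, arranged into
      quotients with known limits. In the last group the squares of the small weights, divided by
      \<delta>^2, sum to 2 for the balanced vector and tend to 1/4 + 9/4 for the spread one; the
      difference - 1/2 yields the coefficient \<alpha> / 4.\<close>
    let ?rhs = "\<lambda>\<delta>. - ((?G (y \<delta>) - ?G x) / \<delta>\<^sup>2)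
      + \<alpha> * (?g (y \<delta>) * ((u \<delta> - 2 * \<delta>) / \<delta>\<^sup>2) + 2 * ((?g (y \<delta>) - ?g x) / \<delta>\<^sup>2 * \<delta>))
      + (g' x / 2 * (4 * \<alpha>\<^sup>2 + 2 * \<alpha>)
      - g' (y \<delta>) / 2 * (\<alpha>\<^sup>2 * (u \<delta> / \<delta>)\<^sup>2 + \<alpha> * (1 / 4 + (u \<delta> / \<delta> - 1 / 2)\<^sup>2)))"
    have "(?rhs \<longlongrightarrow> - (- (?g x * x / \<alpha>))
      + \<alpha> * (?g x * (- (1 / \<alpha>)) + 2 * (- (g' x * x / \<alpha>) * 0))
      + (g' x / 2 * (4 * \<alpha>\<^sup>2 + 2 * \<alpha>) - g' x / 2 * (\<alpha>\<^sup>2 * 2\<^sup>2 + \<alpha> * (1 / 4 + (2 - 1 / 2)\<^sup>2)))) (at_right 0)"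
      by (intro tendsto_intros G_lim gy g'y g_lim u1_lim u2_lim) simp_all
    also have "- (- (?g x * x / \<alpha>))
      + \<alpha> * (?g x * (- (1 / \<alpha>)) + 2 * (- (g' x * x / \<alpha>) * 0))
      + (g' x / 2 * (4 * \<alpha>\<^sup>2 + 2 * \<alpha>) - g' x / 2 * (\<alpha>\<^sup>2 * 2\<^sup>2 + \<alpha> * (1 / 4 + (2 - 1 / 2)\<^sup>2))) = L"
      using assms(1,2) unfolding L_def g'_def by (simp add: field_simps power2_eq_square)
    finally show "(?rhs \<longlongrightarrow> L) (at_right 0)" .
    show "\<forall>\<^sub>F \<delta> in at_right 0. ?rhs \<delta> = (T \<delta> \<delta> x - T (\<delta> / 2) (u \<delta> - \<delta> / 2) (y \<delta>)) / \<delta>\<^sup>2"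
      using pos
    proof eventually_elim
      case (elim \<delta>)
      then show ?case
        by (simp add: T_def field_simps power2_eq_square)
    qed
  qed

  have rest: "((\<lambda>\<delta>. R \<delta> / \<delta>\<^sup>2) \<longlongrightarrow> 0) (at_right 0)"
  proof -
    obtain K where K: "0 \<le> K" "\<And>y p q. y \<in> {x / 2..x} \<Longrightarrow> 0 \<le> p \<Longrightarrow> 0 \<le> q \<Longrightarrow>
        \<bar>E p q y - T p q y\<bar> \<le> K * (p + q) ^ 3"
      using gamma_pair_expansion[OF assms(1), of "x / 2" "1 :: 3" 2 x] assms(2)
      unfolding E_def T_def g'_def by auto
    \<comment> \<open>The first condition keeps the base point in the interval where
      \<open>K\<close> is valid; the second makes the weight
      \<open>u \<delta> - \<delta> / 2\<close> nonnegative.\<close>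
    have "\<forall>\<^sub>F \<delta> in at_right 0. x / 2 < y \<delta>" "\<forall>\<^sub>F \<delta> in at_right 0. 1 < u \<delta> / \<delta>"
      using order_tendstoD(1)[OF y_lim, of "x / 2"] order_tendstoD(1)[OF u1_lim, of 1] assms(2) by auto
    then have "\<forall>\<^sub>F \<delta> in at_right 0. norm (R \<delta> / \<delta>\<^sup>2) \<le> K * 8 * \<delta> + K * (u \<delta> / \<delta>) ^ 3 * \<delta>"
      using pos
    proof eventually_elim
      case (elim \<delta>)
      have y: "y \<delta> \<in> {x / 2..x}"
        using elim \<kappa>_nonneg[of \<delta>] assms(2) mult_left_mono[of 1 "1 + \<kappa> \<delta>" x] by (auto simp: y_def divide_le_eq)
      have "\<bar>E \<delta> \<delta> x - T \<delta> \<delta> x\<bar> \<le> K * (\<delta> + \<delta>) ^ 3"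
        using elim assms(2) by (intro K) auto
      moreover have "\<bar>E (\<delta> / 2) (u \<delta> - \<delta> / 2) (y \<delta>) - T (\<delta> / 2) (u \<delta> - \<delta> / 2) (y \<delta>)\<bar>
          \<le> K * (\<delta> / 2 + (u \<delta> - \<delta> / 2)) ^ 3"
        using elim y by (intro K) (auto simp: less_divide_eq)
      ultimately have "\<bar>R \<delta>\<bar> \<le> K * (\<delta> + \<delta>) ^ 3 + K * (\<delta> / 2 + (u \<delta> - \<delta> / 2)) ^ 3"
        unfolding R_def by linarith
      then have "\<bar>R \<delta>\<bar> / \<delta>\<^sup>2 \<le> (K * (\<delta> + \<delta>) ^ 3 + K * (\<delta> / 2 + (u \<delta> - \<delta> / 2)) ^ 3) / \<delta>\<^sup>2"
        by (rule divide_right_mono) simp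
      also have "\<dots> = K * 8 * \<delta> + K * (u \<delta> / \<delta>) ^ 3 * \<delta>"
        using elim by (simp add: field_simps power2_eq_square power3_eq_cube)
      finally show ?case by simp
    qed
    moreover have "((\<lambda>\<delta>. K * 8 * \<delta> + K * (u \<delta> / \<delta>) ^ 3 * \<delta>) \<longlongrightarrow> 0) (at_right 0)"
      by (rule tendsto_eq_intros u1_lim | simp)+
    ultimately show ?thesis by (rule Lim_null_comparison)
  qed

  have "((\<lambda>\<delta>. (T \<delta> \<delta> x - T (\<delta> / 2) (u \<delta> - \<delta> / 2) (y \<delta>)) / \<delta>\<^sup>2 + R \<delta> / \<delta>\<^sup>2) \<longlongrightarrow> L + 0) (at_right 0)"
    by (intro tendsto_add main rest)
  then show ?thesis
    unfolding weighted_balanced weighted_spread R_def by (simp add: diff_divide_distrib)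
qed

section \<open>Majorization, the choice of the four points and the theorem\<close>

lemma increasing_rearrangement_vector_3:
  assumes "a \<le> b" "b \<le> c"
  shows "increasing_rearrangement (vector [a, b, c] :: real ^ 3) = [a, b, c]"
proof -
  have "image_mset (\<lambda>i. (vector [a, b, c] :: real ^ 3) $ i) (mset_set UNIV) = mset [a, b, c]"
    unfolding UNIV_3_insert by simp
  then show ?thesis
    using assms unfolding increasing_rearrangement_def
    by (simp only: sorted_list_of_multiset_mset) (simp add: sorted_sort_id)
qed

text \<open>For small \<delta> the spread vector is close to (\<delta> / 2, 3 \<delta> / 2, 1), so
  its product is about 3/4 of that of the balanced vector. Its smallest entry is at most \<delta>,
  its two smallest sum to 2 \<delta> - \<kappa>, and both totals are 1 + 2 \<delta>.\<close>

lemma spread_vector_properties: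
  assumes "0 < \<alpha>" "0 < \<delta>" "\<delta> \<le> \<alpha> / 8" "\<delta> \<le> 1 / 8"
  shows "0 < spread_vector \<alpha> \<delta> $ i" "0 < balanced_vector \<delta> $ i"
    "balanced_vector \<delta> \<prec>\<^sub>m spread_vector \<alpha> \<delta>"
    "(\<Prod>i\<in>UNIV. spread_vector \<alpha> \<delta> $ i) < (\<Prod>i\<in>UNIV. balanced_vector \<delta> $ i)"
proof -
  define \<kappa> where "\<kappa> = \<delta>\<^sup>2 / \<alpha>"
  define a where "a = (1 + \<kappa>) * (\<delta> / 2)"
  define b where "b = 2 * \<delta> - \<kappa> - a"
  have "\<delta> * \<delta> \<le> \<delta> * (\<alpha> / 8)"
    using assms by (intro mult_left_mono) auto
  then have \<kappa>: "0 < \<kappa>" "\<kappa> \<le> \<delta> / 8"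
    using assms by (auto simp: \<kappa>_def power2_eq_square field_simps)
  \<comment> \<open>Since \<kappa> \<le> \<delta> / 8 \<le> 1 / 64, the factor 1 + \<kappa> is at
    most 33/32.\<close>
  have a: "\<delta> / 2 \<le> a" "a \<le> 33 / 64 * \<delta>"
    using \<kappa> assms mult_right_mono[of 1 "1 + \<kappa>" "\<delta> / 2"] mult_right_mono[of "1 + \<kappa>" "33 / 32" "\<delta> / 2"]
    by (auto simp: a_def)
  have b: "\<delta> < b" "b \<le> 3 / 2 * \<delta>"
    using \<kappa> a assms by (auto simp: b_def)
  have spread: "spread_vector \<alpha> \<delta> = vector [a, b, 1 + \<kappa>]"
    by (simp add: spread_vector_def a_def b_def \<kappa>_def Let_def)
  have "i = 1 \<or> i = 2 \<or> i = 3"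
    using exhaust_3 by blast
  then show "0 < spread_vector \<alpha> \<delta> $ i" "0 < balanced_vector \<delta> $ i"
    using a b \<kappa> assms by (auto simp: spread balanced_vector_def)
  have "increasing_rearrangement (spread_vector \<alpha> \<delta>) = [a, b, 1 + \<kappa>]"
    unfolding spread using a b \<kappa> assms by (intro increasing_rearrangement_vector_3) auto
  moreover have "increasing_rearrangement (balanced_vector \<delta>) = [\<delta>, \<delta>, 1]"
    unfolding balanced_vector_def using assms by (intro increasing_rearrangement_vector_3) auto
  moreover have "{1..CARD(3)} = {1, 2, 3}"
    by auto
  ultimately show "balanced_vector \<delta> \<prec>\<^sub>m spread_vector \<alpha> \<delta>"
    unfolding majorized_by_def using a b \<kappa> assms
    by (simp add: numeral_3_eq_3 numeral_2_eq_2 b_def)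
  have "a * b * (1 + \<kappa>) \<le> (33 / 64 * \<delta>) * (3 / 2 * \<delta>) * (33 / 32)"
    using a b \<kappa> assms by (intro mult_mono) auto
  also have "\<dots> < \<delta> * \<delta>"
    using assms by simp
  finally show "(\<Prod>i\<in>UNIV. spread_vector \<alpha> \<delta> $ i) < (\<Prod>i\<in>UNIV. balanced_vector \<delta> $ i)"
    unfolding spread balanced_vector_def UNIV_3_insert by (simp add: mult_ac)
qed

lemma sign_changes_on_ge_3:
  assumes "0 < x0" "x0 < x1" "x1 < x2" "x2 < x3"
    and "f x0 < 0" "0 < f x1" "f x2 < 0" "0 < f x3"
  shows "3 \<le> sign_changes_on {0<..} f"
proof -
  let ?xs = "[x0, x1, x2, x3]"
  have "filter (\<lambda>y. y \<noteq> 0) (map f ?xs) = map f ?xs"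
    using assms by simp
  moreover have "{i. Suc i < length (map f ?xs) \<and> map f ?xs ! i * map f ?xs ! Suc i < 0} = {0, 1, 2}"
    using assms by (auto simp: less_Suc_eq numeral_eq_Suc mult_less_0_iff)
  ultimately have "sign_changes_list (map f ?xs) = 3"
    unfolding sign_changes_list_def Let_def by (simp only:) simp
  then have "3 = enat (sign_changes_list (map f ?xs))"
    by (simp add: numeral_eq_enat)
  also have "\<dots> \<le> sign_changes_on {0<..} f"
    unfolding sign_changes_on_def using assms by (intro SUP_upper) auto
  finally show ?thesis .
qed

theorem theorem2:
  fixes \<alpha> :: real
  assumes "0 < \<alpha>" and "\<alpha> < 1"
  shows "\<exists>\<theta> \<eta> :: real ^ 3.
           (\<forall>i. 0 < \<theta> $ i) \<and> (\<forall>i. 0 < \<eta> $ i) \<and> \<eta> \<prec>\<^sub>m \<theta> \<and>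
           3 \<le> sign_changes_on {0<..}
                 (\<lambda>x. weighted_gamma_cdf \<alpha> \<eta> x - weighted_gamma_cdf \<alpha> \<theta> x)"
proof -
  let ?D = "\<lambda>\<delta> x. weighted_gamma_cdf \<alpha> (balanced_vector \<delta>) x - weighted_gamma_cdf \<alpha> (spread_vector \<alpha> \<delta>) x"
  let ?L = "\<lambda>x. x / \<alpha> - 1 + \<alpha> / 4 * (1 + (1 - \<alpha>) / x)"
  \<comment> \<open>This choice makes the term \<alpha> (1 - \<alpha>) / (4 x) of \<open>?L\<close>
    equal to 2, which outweighs - 1.\<close>
  define x1 where "x1 = \<alpha> * (1 - \<alpha>) / 8"
  have x1: "0 < x1" "x1 < \<alpha> / 2"
    using assms mult_strict_left_mono[of "1 - \<alpha>" 4 \<alpha>] by (auto simp: x1_def)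
  have pos: "\<forall>\<^sub>F \<delta> in at_right 0. 0 < ?D \<delta> x" if "0 < x" "0 < ?L x" for x
    using order_tendstoD(1)[OF cdf_difference_limit[OF assms(1) that(1)], of 0] that
      gamma_density_pos[OF assms(1) that(1)]
    by (auto simp: zero_less_divide_iff elim!: eventually_mono)
  have neg: "\<forall>\<^sub>F \<delta> in at_right 0. ?D \<delta> x < 0" if "0 < x" "?L x < 0" for x
    using order_tendstoD(2)[OF cdf_difference_limit[OF assms(1) that(1)], of 0] that
      gamma_density_pos[OF assms(1) that(1)]
    by (auto simp: divide_less_0_iff mult_less_0_iff elim!: eventually_mono)
  have "?L x1 = (1 - \<alpha>) / 8 - 1 + \<alpha> / 4 + 2"
    using assms by (simp add: x1_def field_simps)
  also have "\<dots> > 0"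
    using assms by (simp add: field_simps)
  finally have 1: "\<forall>\<^sub>F \<delta> in at_right 0. 0 < ?D \<delta> x1"
    by (rule pos[OF x1(1)])
  \<comment> \<open>The terms are 1/2 - 1 + \<alpha> / 4 + (1 - \<alpha>) / 2.\<close>
  have "?L (\<alpha> / 2) = - \<alpha> / 4"
    using assms by (simp add: field_simps)
  also have "\<dots> < 0"
    using assms by simp
  finally have 2: "\<forall>\<^sub>F \<delta> in at_right 0. ?D \<delta> (\<alpha> / 2) < 0"
    using assms by (intro neg) simp_all
  have "0 < \<alpha> / 4 * (1 + (1 - \<alpha>) / (2 * \<alpha>))"
    using assms by (intro mult_pos_pos add_pos_pos) auto
  moreover have "2 * \<alpha> / \<alpha> = 2"
    using assms by simp
  ultimately have "0 < ?L (2 * \<alpha>)" by linarith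
  then have 3: "\<forall>\<^sub>F \<delta> in at_right 0. 0 < ?D \<delta> (2 * \<alpha>)"
    using assms by (intro pos) simp_all
  have small: "\<forall>\<^sub>F \<delta> in at_right 0. \<delta> \<in> {0<..<min (\<alpha> / 8) (1 / 8)}"
    using assms by (intro eventually_at_right_real) auto
  \<comment> \<open>One \<delta> is fixed that realizes the three signs of the limit. Only then is
    \<open>x0\<close> taken, below \<open>x1\<close> and depending on this \<delta>, where the
    product comparison gives the opposite sign.\<close>
  obtain \<delta> where \<delta>: "0 < ?D \<delta> x1" "?D \<delta> (\<alpha> / 2) < 0" "0 < ?D \<delta> (2 * \<alpha>)" "\<delta> \<in> {0<..<min (\<alpha> / 8) (1 / 8)}"
    using eventually_happens'[OF _ eventually_conj[OF 1 eventually_conj[OF 2 eventually_conj[OF 3 small]]]]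
    by auto
  then have \<delta>': "0 < \<delta>" "\<delta> \<le> \<alpha> / 8" "\<delta> \<le> 1 / 8" by auto
  note props = spread_vector_properties[OF assms(1) \<delta>']
  have "\<forall>\<^sub>F x in at_right 0. weighted_gamma_cdf \<alpha> (balanced_vector \<delta>) x < weighted_gamma_cdf \<alpha> (spread_vector \<alpha> \<delta>) x"
    by (intro weighted_gamma_cdf_less_near_zero assms(1) props)
  moreover have "\<forall>\<^sub>F x in at_right 0. x \<in> {0<..<x1}"
    using x1 by (intro eventually_at_right_real) auto
  ultimately obtain x0 where x0: "?D \<delta> x0 < 0" "0 < x0" "x0 < x1"
    using eventually_happens'[OF _ eventually_conj, of "at_right (0 :: real)"] by force
  have "3 \<le> sign_changes_on {0<..} (?D \<delta>)"
    using x0 x1 \<delta> assms by (intro sign_changes_on_ge_3[of x0 x1 "\<alpha> / 2" "2 * \<alpha>"]) auto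
  then show ?thesis
    using props by blast
qed

end
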